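(* For every countable abelian group $G$, one has $H^2_{\mathsf{Bor}}(\mathbb{R}^2,G)=0$; that is, every Borel abelian cocycle $C\colon(\mathbb{R}^2)^2\to G$ is a Borel coboundary: there is a Borel map $h\colon\mathbb{R}^2\to G$ with $C(x,y)=h(x)+h(y)-h(x+y)$ for all $x,y\in\mathbb{R}^2$.
   Context: $\mathbb{R}^2$ is the additive group with its usual Polish topology; $G$ carries the discrete topology. An abelian cocycle is a map $C\colon(\mathbb{R}^2)^2\to G$ with $C(x,0)=0$, $C(x,y)=C(y,x)$ and $C(x,y)+C(x+y,z)=C(x,z)+C(x+z,y)$ for all $x,y,z$. A coboundary is a cocycle of the form $C_h(x,y)=h(x)+h(y)-h(x+y)$; a Borel coboundary is one with $h$ Borel. $H^2_{\mathsf{Bor}}(\mathbb{R}^2,G)$ is the group of Borel abelian cocycles modulo Borel coboundaries. *)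

theory Defs
  imports "HOL-Analysis.Analysis" "HOL-Algebra.Elementary_Groups"
begin

definition abelian_cocycle :: "('a::ab_group_add \<times> 'a \<Rightarrow> 'g::ab_group_add) \<Rightarrow> bool" where
  "abelian_cocycle C \<longleftrightarrow>
     (\<forall>x. C (x, 0) = 0) \<and>
     (\<forall>x y. C (x, y) = C (y, x)) \<and>
     (\<forall>x y z. C (x, y) + C (x + y, z) = C (x, z) + C (x + z, y))"

(* The target group is discrete, so its Borel sets are all its subsets. *)
definition borel_map :: "('a::topological_space \<Rightarrow> 'g) \<Rightarrow> bool" where
  "borel_map f \<longleftrightarrow> f \<in> borel \<rightarrow>\<^sub>M count_space UNIV"

definition cobound :: "('a::ab_group_add \<Rightarrow> 'g::ab_group_add) \<Rightarrow> 'a \<times> 'a \<Rightarrow> 'g" where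
  "cobound h = (\<lambda>(x, y). h x + h y - h (x + y))"

(* Requiring a cocycle forces h 0 = 0, because cobound h (x, 0) = h 0. *)
definition borel_coboundary ::
    "('a::{second_countable_topology, topological_ab_group_add} \<times> 'a \<Rightarrow> 'g::ab_group_add) \<Rightarrow> bool" where
  "borel_coboundary C \<longleftrightarrow> abelian_cocycle C \<and> (\<exists>h. borel_map h \<and> C = cobound h)"

definition Z2_Bor ::
    "('a::{second_countable_topology, topological_ab_group_add} \<times> 'a \<Rightarrow> 'g::ab_group_add) monoid" where
  "Z2_Bor = \<lparr>carrier = {C. abelian_cocycle C \<and> borel_map C},
             monoid.mult = (\<lambda>C D p. C p + D p), one = (\<lambda>_. 0)\<rparr>"

definition H2_Bor ::
    "('a::{second_countable_topology, topological_ab_group_add} \<times> 'a \<Rightarrow> 'g::ab_group_add) set monoid" where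
  "H2_Bor = Z2_Bor Mod {C. borel_coboundary C}"

lemma borel_map_add:
  fixes f g :: "'a::topological_space \<Rightarrow> 'g::{ab_group_add, countable}"
  assumes "borel_map f" "borel_map g"
  shows "borel_map (\<lambda>x. f x + g x)"
  unfolding borel_map_def
proof (rule measurable_compose_countable'[where I = UNIV and f = "\<lambda>i x. f x + i" and g = g])
  show "(\<lambda>x. f x + i) \<in> borel \<rightarrow>\<^sub>M count_space UNIV" for i
    using assms(1) unfolding borel_map_def by (rule measurable_compose) simp
  show "g \<in> borel \<rightarrow>\<^sub>M count_space UNIV"
    using assms(2) unfolding borel_map_def .
qed simp

lemma borel_map_uminus:
  fixes f :: "'a::topological_space \<Rightarrow> 'g::ab_group_add"
  assumes "borel_map f"
  shows "borel_map (\<lambda>x. - f x)"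
  using assms unfolding borel_map_def by (rule measurable_compose) simp

lemma borel_map_zero: "borel_map (\<lambda>_. 0)"
  unfolding borel_map_def by simp

lemma abelian_cocycle_add:
  assumes "abelian_cocycle C" "abelian_cocycle D"
  shows "abelian_cocycle (\<lambda>p. C p + D p)"
  unfolding abelian_cocycle_def
proof (intro conjI allI)
  fix x y z
  show "C (x, 0) + D (x, 0) = 0"
    using assms unfolding abelian_cocycle_def by (metis add_0)
  show "C (x, y) + D (x, y) = C (y, x) + D (y, x)"
    using assms unfolding abelian_cocycle_def by metis
  have "C (x, y) + C (x + y, z) = C (x, z) + C (x + z, y)"
       "D (x, y) + D (x + y, z) = D (x, z) + D (x + z, y)"
    using assms unfolding abelian_cocycle_def by blast+
  then have "(C (x, y) + C (x + y, z)) + (D (x, y) + D (x + y, z)) =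
             (C (x, z) + C (x + z, y)) + (D (x, z) + D (x + z, y))" by (simp only:)
  then show "C (x, y) + D (x, y) + (C (x + y, z) + D (x + y, z)) =
             C (x, z) + D (x, z) + (C (x + z, y) + D (x + z, y))" by (simp only: add_ac)
qed

lemma abelian_cocycle_uminus:
  assumes "abelian_cocycle C"
  shows "abelian_cocycle (\<lambda>p. - C p)"
  unfolding abelian_cocycle_def
proof (intro conjI allI)
  fix x y z
  show "- C (x, 0) = 0"
    using assms unfolding abelian_cocycle_def by (metis neg_equal_0_iff_equal)
  show "- C (x, y) = - C (y, x)"
    using assms unfolding abelian_cocycle_def by metis
  have "C (x, y) + C (x + y, z) = C (x, z) + C (x + z, y)"
    using assms unfolding abelian_cocycle_def by blast
  then have "- (C (x, y) + C (x + y, z)) = - (C (x, z) + C (x + z, y))" by (simp only:)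
  then show "- C (x, y) + - C (x + y, z) = - C (x, z) + - C (x + z, y)"
    by (simp only: minus_add_distrib)
qed

lemma comm_group_Z2_Bor:
  "comm_group (Z2_Bor :: ('a::{second_countable_topology, topological_ab_group_add} \<times> 'a \<Rightarrow>
     'g::{ab_group_add, countable}) monoid)"
proof (rule comm_groupI)
  fix C :: "'a \<times> 'a \<Rightarrow> 'g"
  assume "C \<in> carrier Z2_Bor"
  then show "\<exists>D\<in>carrier Z2_Bor. D \<otimes>\<^bsub>Z2_Bor\<^esub> C = \<one>\<^bsub>Z2_Bor\<^esub>"
    by (intro bexI[of _ "\<lambda>p. - C p"])
       (simp_all add: Z2_Bor_def abelian_cocycle_uminus borel_map_uminus)
qed (simp_all add: Z2_Bor_def abelian_cocycle_add borel_map_add borel_map_zero add_ac,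
     simp add: abelian_cocycle_def)

lemma borel_map_cobound:
  fixes h :: "'a::{second_countable_topology, topological_ab_group_add} \<Rightarrow>
    'g::{ab_group_add, countable}"
  assumes "borel_map h"
  shows "borel_map (cobound h)"
proof -
  have comp: "borel_map (\<lambda>p. h (t p))"
    if "continuous_on UNIV t" for t :: "'a \<times> 'a \<Rightarrow> 'a"
    using borel_measurable_continuous_onI[OF that] assms unfolding borel_map_def
    by (rule measurable_compose)
  have "borel_map (\<lambda>p. h (fst p) + h (snd p) + - h (fst p + snd p))"
    by (intro borel_map_add borel_map_uminus comp continuous_intros)
  then show ?thesis
    by (simp add: cobound_def case_prod_beta')
qed

lemma subgroup_borel_coboundary:
  "subgroup {C. borel_coboundary C}
     (Z2_Bor :: ('a::{second_countable_topology, topological_ab_group_add} \<times> 'a \<Rightarrow>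
       'g::{ab_group_add, countable}) monoid)"
proof (rule group.subgroupI[OF comm_group.axioms(2)[OF comm_group_Z2_Bor]])
  show "{C. borel_coboundary C} \<subseteq> carrier (Z2_Bor :: ('a \<times> 'a \<Rightarrow> 'g) monoid)"
    by (auto simp: Z2_Bor_def borel_coboundary_def borel_map_cobound)
  have "borel_coboundary (\<lambda>_ :: 'a \<times> 'a. 0 :: 'g)"
    unfolding borel_coboundary_def
    by (intro conjI exI[of _ "\<lambda>_. 0"]) (auto simp: abelian_cocycle_def borel_map_zero cobound_def)
  then show "{C :: 'a \<times> 'a \<Rightarrow> 'g. borel_coboundary C} \<noteq> {}" by blast
next
  fix C D :: "'a \<times> 'a \<Rightarrow> 'g"
  assume "C \<in> {C. borel_coboundary C}" "D \<in> {C. borel_coboundary C}"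
  then obtain h k where "abelian_cocycle C" "borel_map h" "C = cobound h"
    and "abelian_cocycle D" "borel_map k" "D = cobound k"
    by (auto simp: borel_coboundary_def)
  moreover have "(\<lambda>p. cobound h p + cobound k p) = cobound (\<lambda>x. h x + k x)"
    by (auto simp: cobound_def)
  ultimately show "C \<otimes>\<^bsub>Z2_Bor\<^esub> D \<in> {C. borel_coboundary C}"
    using abelian_cocycle_add[of C D] borel_map_add[of h k]
    by (auto simp: Z2_Bor_def borel_coboundary_def)
next
  fix C :: "'a \<times> 'a \<Rightarrow> 'g"
  assume "C \<in> {C. borel_coboundary C}"
  then obtain h where h: "abelian_cocycle C" "borel_map h" "C = cobound h"
    by (auto simp: borel_coboundary_def)
  interpret comm_group "Z2_Bor :: ('a \<times> 'a \<Rightarrow> 'g) monoid" by (rule comm_group_Z2_Bor)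
  have "inv\<^bsub>Z2_Bor\<^esub> C = (\<lambda>p. - C p)"
    by (rule inv_equality)
       (use h in \<open>simp_all add: Z2_Bor_def abelian_cocycle_uminus borel_map_uminus borel_map_cobound\<close>)
  moreover have "(\<lambda>p. - cobound h p) = cobound (\<lambda>x. - h x)"
    by (auto simp: cobound_def)
  ultimately show "inv\<^bsub>Z2_Bor\<^esub> C \<in> {C. borel_coboundary C}"
    using h abelian_cocycle_uminus[of C] borel_map_uminus[of h]
    by (auto simp: borel_coboundary_def)
qed

end

(* By the cocycle identity and symmetry, C(x,y) - C(x,z) = C(y,z+x) - C(y+x,z). Translations act
   continuously in measure on measurable maps to a countable set, so for small x the right-hand side
   vanishes for most (y,z) in a ball; hence C(x,.) takes a single value h(x) off a small set.
   Evaluating the cocycle identity at a generic third argument w gives C(x,y) = h(x) + h(y) - h(x+y)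
   for x, y, x+y near 0, and the doubling recursion h(2a) = 2 h(a) - C(a,a) propagates
   this from a ball of radius r to all of the balls of radius 2^j r. *)

theory Submission
  imports Defs
begin

section \<open>Borel maps into a discrete set, and translation invariance of Lebesgue
  measure\<close>

lemma vimage_borel_map:
  assumes "borel_map f"
  shows "f -` A \<in> sets borel"
  using measurable_sets[of f borel "count_space UNIV" A] assms
  by (simp add: borel_map_def)

lemma borel_map_compose_continuous:
  assumes "borel_map F" "continuous_on UNIV t"
  shows "borel_map (\<lambda>x. F (t x))"
  using borel_measurable_continuous_onI[OF assms(2)] assms(1) unfolding borel_map_def
  by (rule measurable_compose)

lemma emeasure_lborel_vimage_add:
  fixes v :: "'a::euclidean_space"
  assumes "A \<in> sets borel"
  shows "emeasure lborel {p. p + v \<in> A} = emeasure lborel A"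
proof -
  have "emeasure lborel A = emeasure (distr lborel borel ((+) v)) A"
    by (simp add: lborel_distr_plus)
  also have "\<dots> = emeasure lborel ((+) v -` A \<inter> space lborel)"
    using assms by (intro emeasure_distr) auto
  also have "(+) v -` A \<inter> space lborel = {p. p + v \<in> A}"
    by (auto simp: add.commute)
  finally show ?thesis by simp
qed

section \<open>Lusin approximation and continuity of translations in measure\<close>

text \<open>Each fibre of \<open>f\<close> contains a closed set filling it up to a small error, and
  finitely many of these closed sets already fill most of the ball. Coding values by
  \<open>to_nat\<close> and \<open>real\<close> gives a metric target, so that uniform continuity
  becomes available.\<close>

lemma borel_map_Lusin:
  fixes f :: "'a::euclidean_space \<Rightarrow> 'g::countable"
  assumes f: "borel_map f" and e: "e > 0"
  obtains K where "compact K" "K \<subseteq> cball 0 R" "emeasure lborel (cball 0 R - K) < ennreal e"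
    "continuous_on K (\<lambda>x. real (to_nat (f x)))"
proof -
  define A where "A k = {x. to_nat (f x) = k}" for k
  have Ab: "A k \<in> sets borel" for k
    using vimage_borel_map[OF f, of "to_nat -` {k}"] by (simp add: A_def vimage_def)
  \<comment> \<open>The errors sum to \<open>e/2\<close>, so the bound stays strictly below
    \<open>e\<close> after the countable sum.\<close>
  have "\<exists>T. closed T \<and> T \<subseteq> A k \<and> emeasure lborel (A k - T) < ennreal (e/2 * (1/2)^(Suc k))" for k
  proof -
    have "A k \<in> sets lebesgue" "e/2 * (1/2)^(Suc k) > 0" using Ab[of k] e by auto
    then obtain T where "closed T" "T \<subseteq> A k" "emeasure lebesgue (A k - T) < ennreal (e/2 * (1/2)^(Suc k))"
      by (rule sets_lebesgue_inner_closed)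
    moreover have "emeasure lebesgue (A k - T) = emeasure lborel (A k - T)"
      using Ab[of k] \<open>closed T\<close> by simp
    ultimately show ?thesis by auto
  qed
  then obtain T where T: "\<And>k. closed (T k)" "\<And>k. T k \<subseteq> A k"
    "\<And>k. emeasure lborel (A k - T k) < ennreal (e/2 * (1/2)^(Suc k))" by metis
  have Tb[measurable]: "T k \<in> sets borel" for k using T(1) by auto
  define B where "B n = cball (0::'a) R - (\<Union>k<n. T k)" for n
  have Bb: "B n \<in> sets lborel" for n unfolding B_def by auto
  \<comment> \<open>A point \<open>x\<close> of the ball missed by every \<open>T k\<close> lies in
    \<open>A k - T k\<close> for \<open>k = to_nat (f x)\<close>.\<close>
  have "(\<Inter>n. B n) \<subseteq> (\<Union>k. A k - T k)" by (auto simp: B_def A_def)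
  then have "emeasure lborel (\<Inter>n. B n) \<le> emeasure lborel (\<Union>k. A k - T k)"
    using Ab by (intro emeasure_mono) auto
  also have "\<dots> \<le> (\<Sum>k. emeasure lborel (A k - T k))"
    using Ab by (intro emeasure_subadditive_countably) auto
  also have "\<dots> \<le> (\<Sum>k. ennreal (e/2 * (1/2)^(Suc k)))"
    using T(3) by (intro suminf_le less_imp_le) auto
  also have "\<dots> = ennreal (e/2)"
    using sums_mult[OF power_half_series, of "e/2"] e by (intro suminf_ennreal_eq) auto
  finally have lt: "emeasure lborel (\<Inter>n. B n) < ennreal e"
    by (rule le_less_trans) (use e in \<open>auto intro: ennreal_lessI\<close>)
  \<comment> \<open>Continuity from above, available because the ball has finite measure, lets
    finitely many of the \<open>T k\<close> suffice.\<close>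
  have "(\<lambda>n. emeasure lborel (B n)) \<longlonglongrightarrow> emeasure lborel (\<Inter>n. B n)"
  proof (rule Lim_emeasure_decseq)
    show "emeasure lborel (B n) \<noteq> \<infinity>" for n
    proof -
      have "emeasure lborel (B n) \<le> emeasure lborel (cball (0::'a) R)"
        by (intro emeasure_mono) (auto simp: B_def)
      then show ?thesis using emeasure_lborel_cball_finite[of "0::'a" R] by (auto simp: top_unique)
    qed
  qed (use Bb in \<open>auto simp: decseq_def B_def\<close>)
  then have "\<forall>\<^sub>F n in sequentially. emeasure lborel (B n) < ennreal e"
    using lt by (rule order_tendstoD)
  then obtain n where n: "emeasure lborel (B n) < ennreal e"
    by (auto simp: eventually_sequentially)
  define K where "K = (\<Union>k<n. T k \<inter> cball 0 R)"
  show thesis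
  proof
    show "compact K" unfolding K_def using T(1) by (intro compact_UN) (auto intro: closed_Int_compact)
    show "K \<subseteq> cball 0 R" by (auto simp: K_def)
    have "cball 0 R - K = B n" by (auto simp: K_def B_def)
    then show "emeasure lborel (cball 0 R - K) < ennreal e" using n by simp
    have "continuous_on (T k \<inter> cball 0 R) (\<lambda>x. real (to_nat (f x)))" for k
      by (rule continuous_on_eq[where f = "\<lambda>_. real k"]) (use T(2)[of k] in \<open>auto simp: A_def\<close>)
    then show "continuous_on K (\<lambda>x. real (to_nat (f x)))"
      unfolding K_def using T(1) by (intro continuous_on_closed_Union) auto
  qed
qed

text \<open>On a compact Lusin set \<open>K\<close> the coded map is uniformly continuous and
  integer-valued, so short moves within \<open>K\<close> do not change \<open>f\<close>. A failure
  at \<open>p\<close> puts \<open>p\<close> or \<open>p + v\<close> outside \<open>K\<close>, and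
  translation invariance gives both events the same bound.\<close>

lemma borel_map_translation_continuous:
  fixes f :: "'a::euclidean_space \<Rightarrow> 'g::countable"
  assumes f: "borel_map f" and e: "e > 0"
  obtains d where "d > 0"
    "\<And>v. norm v < d \<Longrightarrow> emeasure lborel {p \<in> ball 0 R. f (p + v) \<noteq> f p} < ennreal e"
proof -
  \<comment> \<open>The radius \<open>R + 1\<close> leaves room for \<open>p + v\<close> when
    \<open>norm v < 1\<close>; the exceptional set is counted twice, hence
    \<open>e/2\<close>.\<close>
  obtain K where K: "compact K" "K \<subseteq> cball 0 (R + 1)"
    "emeasure lborel (cball 0 (R + 1) - K) < ennreal (e/2)"
    "continuous_on K (\<lambda>x. real (to_nat (f x)))"
    using borel_map_Lusin[OF f, of "e/2" "R + 1"] e by auto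
  then obtain d where d: "d > 0"
    "\<And>p q. p \<in> K \<Longrightarrow> q \<in> K \<Longrightarrow> dist q p < d \<Longrightarrow> dist (real (to_nat (f q))) (real (to_nat (f p))) < 1"
    using uniformly_continuous_onE[OF compact_uniformly_continuous[OF K(4,1)] zero_less_one] by blast
  have feq: "f q = f p" if "p \<in> K" "q \<in> K" "dist q p < d" for p q
  proof -
    have "\<bar>real (to_nat (f q)) - real (to_nat (f p))\<bar> < 1"
      using d(2)[OF that] by (simp only: dist_real_def)
    then have "to_nat (f q) = to_nat (f p)" by linarith
    then show ?thesis by simp
  qed
  let ?L = "cball 0 (R + 1) - K"
  have Lb: "?L \<in> sets borel" using K(1) by (auto intro: borel_compact)
  show thesis
  proof
    show "min d 1 > 0" using d by auto
    fix v :: 'a assume v: "norm v < min d 1"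
    have Lv: "{p. p + v \<in> ?L} \<in> sets borel"
      using measurable_sets[of "\<lambda>p. p + v" borel borel ?L] Lb by (simp add: vimage_def)
    have "{p \<in> ball 0 R. f (p + v) \<noteq> f p} \<subseteq> ?L \<union> {p. p + v \<in> ?L}"
    proof
      fix p assume p: "p \<in> {p \<in> ball 0 R. f (p + v) \<noteq> f p}"
      have "norm (p + v) \<le> norm p + norm v" by (rule norm_triangle_ineq)
      moreover have "\<not> (p \<in> K \<and> p + v \<in> K)" using feq[of p "p + v"] p v by (auto simp: dist_norm)
      ultimately show "p \<in> ?L \<union> {p. p + v \<in> ?L}" using p v by auto
    qed
    then have "emeasure lborel {p \<in> ball 0 R. f (p + v) \<noteq> f p} \<le> emeasure lborel (?L \<union> {p. p + v \<in> ?L})"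
      using Lb Lv by (intro emeasure_mono) auto
    also have "\<dots> \<le> emeasure lborel ?L + emeasure lborel {p. p + v \<in> ?L}"
      using Lb Lv by (intro emeasure_subadditive) auto
    also have "\<dots> = emeasure lborel ?L + emeasure lborel ?L"
      using emeasure_lborel_vimage_add[OF Lb] by simp
    also have "\<dots> < ennreal (e/2) + ennreal (e/2)"
      using K(3) by (intro add_strict_mono)
    also have "\<dots> = ennreal e" using e by (simp flip: ennreal_plus)
    finally show "emeasure lborel {p \<in> ball 0 R. f (p + v) \<noteq> f p} < ennreal e" .
  qed
qed

section \<open>Algebraic consequences of the cocycle identity\<close>

lemma abelian_cocycle_commute: "abelian_cocycle C \<Longrightarrow> C (x, y) = C (y, x)"
  and abelian_cocycle_assoc:
    "abelian_cocycle C \<Longrightarrow> C (x, y) + C (x + y, z) = C (x, z) + C (x + z, y)"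
  unfolding abelian_cocycle_def by blast+

text \<open>Both sides are the total defect of summing a, a, b, b, grouped as (a+a)+(b+b) on the
  left and as (a+b)+(a+b) on the right. This drives the passage from a ball to the ball of twice its
  radius.\<close>

lemma abelian_cocycle_double:
  assumes C: "abelian_cocycle C"
  shows "C (a + a, b + b) + C (a, a) + C (b, b) = C (a, b) + C (a, b) + C (a + b, a + b)"
proof -
  have 1: "C (b, b) + C (b + b, a + a) = C (b, a + a) + C (b + (a + a), b)"
    by (rule abelian_cocycle_assoc[OF C])
  have 2: "C (a, a) + C (a + a, b) = C (a, b) + C (a + b, a)"
    by (rule abelian_cocycle_assoc[OF C])
  have 3: "C (a, b) + C (a + b, a + b) = C (a, a + b) + C (a + (a + b), b)"
    by (rule abelian_cocycle_assoc[OF C])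
  have comm: "C (b + b, a + a) = C (a + a, b + b)" "C (b, a + a) = C (a + a, b)"
    "C (a, a + b) = C (a + b, a)"
    by (rule abelian_cocycle_commute[OF C])+
  have eq: "b + (a + a) = a + (a + b)" by (simp add: ac_simps)
  have "C (a + a, b + b) + C (a, a) + C (b, b) = (C (b, b) + C (b + b, a + a)) + C (a, a)"
    by (simp add: comm ac_simps)
  also have "\<dots> = (C (a, a) + C (a + a, b)) + C (a + (a + b), b)"
    unfolding 1 by (simp add: comm eq ac_simps)
  also have "\<dots> = C (a, b) + (C (a, a + b) + C (a + (a + b), b))"
    unfolding 2 by (simp add: comm ac_simps)
  also have "\<dots> = C (a, b) + C (a, b) + C (a + b, a + b)"
    unfolding 3[symmetric] by (simp add: ac_simps)
  finally show ?thesis .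
qed

section \<open>Trivialization near the origin\<close>

text \<open>A Fubini argument: the pairs (y,z) with C(x,y) and C(x,z) different form a set of small
  product measure, so its section over some y is small, and then g = C(x,y) works.\<close>

lemma abelian_cocycle_locally_almost_constant:
  fixes C :: "'a::euclidean_space \<times> 'a \<Rightarrow> 'g::{ab_group_add, countable}"
  assumes C: "abelian_cocycle C" and b: "borel_map C" and c: "c > 0"
  obtains r where "r > 0"
    "\<And>x. norm x < r \<Longrightarrow> \<exists>g. emeasure lborel {y \<in> ball 0 1. C (x, y) \<noteq> g} < ennreal c"
proof -
  let ?B = "ball (0::'a) 1"
  define m where "m = measure lborel ?B"
  have m: "emeasure lborel ?B = ennreal m" "m > 0"
    using emeasure_lborel_ball_finite[of "0::'a" 1] content_ball_pos[of 1 "0::'a"]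
    by (auto simp: m_def emeasure_eq_ennreal_measure)
  \<comment> \<open>The translations by (x,0) and (0,x) each get half of the budget
    \<open>c * m\<close>; the ball of radius 2 contains the product of two unit balls.\<close>
  obtain d where d: "d > 0"
    "\<And>v. norm v < d \<Longrightarrow> emeasure lborel {p \<in> ball 0 2. C (p + v) \<noteq> C p} < ennreal (c * m / 2)"
    using borel_map_translation_continuous[OF b, of "c * m / 2" 2] c m(2) by auto
  show thesis
  proof
    show "d > 0" by fact
    fix x :: 'a assume x: "norm x < d"
    let ?D = "\<lambda>v. {p \<in> ball 0 2. C (p + v) \<noteq> C p}"
    let ?X = "{p \<in> ?B \<times> ?B. C (x, fst p) \<noteq> C (x, snd p)}"
    have shift: "borel_map (\<lambda>q. C (t q))" if "continuous_on UNIV t" 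
      for t :: "'b::euclidean_space \<Rightarrow> 'a \<times> 'a"
      using b that by (rule borel_map_compose_continuous)
    have ne: "{q. F q \<noteq> G q} \<in> sets borel" if "borel_map F" "borel_map G" 
      for F G :: "'b::euclidean_space \<Rightarrow> 'g"
      using vimage_borel_map[OF borel_map_add[OF that(1) borel_map_uminus[OF that(2)]], of "- {0}"]
      by (simp add: vimage_def)
    have Db: "?D v \<in> sets borel" for v
    proof -
      have "?D v = ball 0 2 \<inter> {p. C (p + v) \<noteq> C p}" by auto
      moreover have "{p. C (p + v) \<noteq> C p} \<in> sets borel"
        by (intro ne shift b continuous_intros)
      ultimately show ?thesis by simp
    qed
    have "?X = (?B \<times> ?B) \<inter> {p. C (x, fst p) \<noteq> C (x, snd p)}" by auto
    moreover have "{p. C (x, fst p) \<noteq> C (x, snd p)} \<in> sets borel"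
      by (intro ne shift continuous_intros)
    moreover have "?B \<times> ?B \<in> sets borel" by (auto intro!: borel_open open_Times)
    ultimately have Xb: "?X \<in> sets borel" by auto
    \<comment> \<open>Since C(y+x,z) - C(y,z+x) = C(x,z) - C(x,y), a nonzero right-hand side
      prevents both terms on the left from equalling C(y,z).\<close>
    have "?X \<subseteq> ?D (0, x) \<union> ?D (x, 0)"
    proof (intro subsetI UnCI)
      fix p assume p: "p \<in> ?X" "p \<notin> ?D (x, 0)"
      obtain y z where [simp]: "p = (y, z)" by (cases p)
      have yz: "(y, z) \<notin> ?D (x, 0)" "y \<in> ?B" "z \<in> ?B" and n: "C (x, y) \<noteq> C (x, z)"
        using p by auto
      have "norm (y, z) \<le> norm y + norm z" by (rule norm_Pair_le)
      then have B2: "(y, z) \<in> ball 0 2" using yz by auto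
      have "C (y + x, z) = C (y, z)" using yz B2 by auto
      moreover have "C (x, y) + C (x + y, z) = C (x, z) + C (x + z, y)"
        by (rule abelian_cocycle_assoc[OF C])
      moreover have "C (x + z, y) = C (y, z + x)"
        using abelian_cocycle_commute[OF C, of "x + z" y] by (simp add: add.commute)
      ultimately have "C (y, z + x) \<noteq> C (y, z)" using n by (auto simp: add.commute)
      then show "p \<in> ?D (0, x)" using B2 by simp
    qed
    then have "emeasure lborel ?X \<le> emeasure lborel (?D (0, x) \<union> ?D (x, 0))"
      using Db by (intro emeasure_mono) auto
    also have "\<dots> \<le> emeasure lborel (?D (0, x)) + emeasure lborel (?D (x, 0))"
      using Db by (intro emeasure_subadditive) auto
    also have "\<dots> < ennreal (c * m / 2) + ennreal (c * m / 2)"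
      using x by (intro add_strict_mono d(2)) auto
    also have "\<dots> = ennreal (c * m)" using c m(2) by (simp flip: ennreal_plus)
    finally have Xlt: "emeasure lborel ?X < ennreal (c * m)" .
    show "\<exists>g. emeasure lborel {y \<in> ?B. C (x, y) \<noteq> g} < ennreal c"
    proof (rule ccontr)
      assume "\<not> ?thesis"
      then have ge: "ennreal c \<le> emeasure lborel {y \<in> ?B. C (x, y) \<noteq> g}" for g
        by (auto simp: not_less)
      have "ennreal (c * m) = (\<integral>\<^sup>+ y. ennreal c * indicator ?B y \<partial>lborel)"
        using c m by (simp add: nn_integral_cmult_indicator ennreal_mult)
      \<comment> \<open>The section of \<open>?X\<close> over \<open>y\<close> is the exceptional
        set of the candidate value \<open>C (x, y)\<close>, so \<open>ge\<close> bounds it from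
        below.\<close>
      also have "\<dots> \<le> (\<integral>\<^sup>+ y. emeasure lborel (Pair y -` ?X) \<partial>lborel)"
      proof (rule nn_integral_mono)
        fix y :: 'a
        have "Pair y -` ?X = {z \<in> ?B. C (x, z) \<noteq> C (x, y)}" if "y \<in> ?B" using that by auto
        then show "ennreal c * indicator ?B y \<le> emeasure lborel (Pair y -` ?X)"
          using ge by (auto simp: indicator_def)
      qed
      also have "\<dots> = emeasure (lborel \<Otimes>\<^sub>M lborel) ?X"
        using Xb by (intro lborel.emeasure_pair_measure_alt[symmetric]) (simp only: lborel_prod sets_lborel)
      also have "\<dots> = emeasure lborel ?X" by (simp add: lborel_prod)
      finally show False using Xlt by simp
    qed
  qed
qed

text \<open>One test point \<open>w\<close> must avoid the exceptional sets of x, y and x+y, the one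
  of y being shifted by x. Each has measure below a third of that of the half-radius ball
  \<open>B'\<close>, so \<open>w\<close> exists there; the smaller radius keeps \<open>w + x\<close>
  in the unit ball.\<close>

lemma abelian_cocycle_local_cobound:
  fixes C :: "'a::euclidean_space \<times> 'a \<Rightarrow> 'g::{ab_group_add, countable}"
  assumes C: "abelian_cocycle C" and b: "borel_map C"
  obtains r h where "r > 0" "borel_map h"
    "\<And>x y. norm x < r \<Longrightarrow> norm y < r \<Longrightarrow> norm (x + y) < r \<Longrightarrow> C (x, y) = h x + h y - h (x + y)"
proof -
  define B where "B = ball (0::'a) 1"
  define B' where "B' = ball (0::'a) (1/2)"
  define c where "c = measure lborel B' / 3"
  have c: "emeasure lborel B' = ennreal (3 * c)" "c > 0"
    using emeasure_lborel_ball_finite[of "0::'a" "1/2"] content_ball_pos[of "1/2" "0::'a"]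
    by (auto simp: c_def B'_def emeasure_eq_ennreal_measure)
  obtain r where r: "r > 0"
    "\<And>x. norm x < r \<Longrightarrow> \<exists>g. emeasure lborel {y \<in> B. C (x, y) \<noteq> g} < ennreal c"
    unfolding B_def using abelian_cocycle_locally_almost_constant[OF C b c(2)] by blast
  define P where "P x g \<longleftrightarrow> emeasure lborel {y \<in> B. C (x, y) \<noteq> g} < ennreal c" for x g
  \<comment> \<open>The exceptional sets are sections of one Borel set, which makes their measure a
    Borel function of \<open>x\<close>.\<close>
  have Qb: "{p \<in> UNIV \<times> B. C p \<noteq> g} \<in> sets borel" for g
  proof -
    have "{p \<in> UNIV \<times> B. C p \<noteq> g} = (UNIV \<times> B) \<inter> C -` (- {g})" by auto
    moreover have "open (UNIV \<times> B :: ('a \<times> 'a) set)" by (simp add: B_def open_Times)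
    ultimately show ?thesis
      using vimage_borel_map[OF b, of "- {g}"] by (simp add: sets.Int borel_open)
  qed
  have sec: "Pair x -` {p \<in> UNIV \<times> B. C p \<noteq> g} = {y \<in> B. C (x, y) \<noteq> g}" for x g by auto
  have Sb: "{y \<in> B. C (x, y) \<noteq> g} \<in> sets borel" for x g
    using sets_Pair1[of "{p \<in> UNIV \<times> B. C p \<noteq> g}" lborel lborel x] Qb[of g] sec[of x g]
    by (simp only: lborel_prod sets_lborel)
  have cover: "\<exists>y\<in>B'. y \<notin> S1 \<and> y \<notin> S2 \<and> y \<notin> S3"
    if S: "S1 \<in> sets borel" "S2 \<in> sets borel" "S3 \<in> sets borel"
      "emeasure lborel S1 < ennreal c" "emeasure lborel S2 < ennreal c"
      "emeasure lborel S3 < ennreal c" for S1 S2 S3 :: "'a set"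
  proof (rule ccontr)
    assume "\<not> ?thesis"
    then have "emeasure lborel B' \<le> emeasure lborel (S1 \<union> S2 \<union> S3)"
      using S by (intro emeasure_mono) auto
    also have "\<dots> \<le> emeasure lborel (S1 \<union> S2) + emeasure lborel S3"
      using S by (intro emeasure_subadditive) auto
    also have "\<dots> \<le> (emeasure lborel S1 + emeasure lborel S2) + emeasure lborel S3"
      using S by (intro add_right_mono emeasure_subadditive) auto
    also have "\<dots> < (ennreal c + ennreal c) + ennreal c"
      using S by (intro add_strict_mono)
    also have "\<dots> = ennreal (3 * c)" using c(2) by (simp flip: ennreal_plus)
    finally show False using c(1) by simp
  qed
  \<comment> \<open>Two candidate values are compared at a point where both are attained; one
    exceptional set is repeated to fill the three slots of \<open>cover\<close>.\<close>
  have uniq: "g = g'" if "P x g" "P x g'" for x g g'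
  proof -
    have "\<exists>y\<in>B'. y \<notin> {y \<in> B. C (x, y) \<noteq> g} \<and> y \<notin> {y \<in> B. C (x, y) \<noteq> g'} \<and>
        y \<notin> {y \<in> B. C (x, y) \<noteq> g'}"
      using that unfolding P_def by (intro cover Sb)
    then show ?thesis by (auto simp: B_def B'_def)
  qed
  \<comment> \<open>The default 0 is taken where no almost-constant value exists, so the fibre over
    0 also contains the complement of all the sets in \<open>Pb\<close>.\<close>
  define h where "h x = (if \<exists>g. P x g then THE g. P x g else 0)" for x
  have hP: "h x = g" if "P x g" for x g
    using that uniq unfolding h_def by (auto intro!: the_equality)
  have h0: "h x = 0" if "\<And>g. \<not> P x g" for x
    using that by (simp add: h_def)
  have Ph: "P x (h x)" if "norm x < r" for x
    using r(2)[OF that] hP unfolding P_def by metis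
  have Pb: "{x. P x g} \<in> sets borel" for g
  proof -
    have "(\<lambda>x. emeasure lborel {y \<in> B. C (x, y) \<noteq> g}) \<in> borel_measurable lborel"
      using lborel.measurable_emeasure_Pair[of "{p \<in> UNIV \<times> B. C p \<noteq> g}" lborel] Qb[of g]
      by (simp only: lborel_prod sets_lborel sec)
    then show ?thesis unfolding P_def by simp
  qed
  have hb: "borel_map h"
    unfolding borel_map_def
  proof (rule measurableI)
    have eq: "{x. h x = g} = {x. P x g} \<union> (if g = 0 then - (\<Union>g. {x. P x g}) else {})" for g
    proof -
      have "h x = g \<longleftrightarrow> P x g \<or> g = 0 \<and> (\<forall>g. \<not> P x g)" for x
        using hP h0 by metis
      then show ?thesis by auto
    qed
    have "{x. h x = g} \<in> sets borel" for g
      unfolding eq using Pb by auto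
    then have "(\<Union>g\<in>A. {x. h x = g}) \<in> sets borel" for A
      by (intro sets.countable_UN') auto
    moreover have "h -` A = (\<Union>g\<in>A. {x. h x = g})" for A by auto
    ultimately show "h -` A \<inter> space borel \<in> sets borel" for A by simp
  qed simp
  show thesis
  proof
    show "min r (1/2) > 0" using r by auto
    show "borel_map h" by fact
    fix x y :: 'a
    assume xy: "norm x < min r (1/2)" "norm y < min r (1/2)" "norm (x + y) < min r (1/2)"
    let ?S = "\<lambda>x. {w \<in> B. C (x, w) \<noteq> h x}"
    \<comment> \<open>The shift appears because the term C(x+w,y) equals C(y,w+x), which is compared
      with \<open>h y\<close>.\<close>
    have "{w. w + x \<in> ?S y} \<in> sets borel"
      using measurable_sets[of "\<lambda>w. w + x" borel borel "?S y"] Sb by (simp add: vimage_def)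
    moreover have "emeasure lborel {w. w + x \<in> ?S y} < ennreal c"
      using emeasure_lborel_vimage_add[OF Sb, of x y] Ph[of y] xy by (simp add: P_def)
    moreover have "emeasure lborel (?S x) < ennreal c" "emeasure lborel (?S (x + y)) < ennreal c"
      using Ph[of x] Ph[of "x + y"] xy by (auto simp: P_def)
    ultimately obtain w where w: "w \<in> B'" "w \<notin> ?S x" "w \<notin> ?S (x + y)" "w \<notin> {w. w + x \<in> ?S y}"
      using cover[OF Sb Sb] by blast
    have "norm (w + x) \<le> norm w + norm x" by (rule norm_triangle_ineq)
    then have "w \<in> B" "w + x \<in> B" using w(1) xy by (auto simp: B_def B'_def)
    then have "C (x, w) = h x" "C (x + y, w) = h (x + y)" "C (y, w + x) = h y"
      using w by auto
    moreover have "C (x, y) + C (x + y, w) = C (x, w) + C (x + w, y)"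
      by (rule abelian_cocycle_assoc[OF C])
    moreover have "C (x + w, y) = C (y, w + x)"
      using abelian_cocycle_commute[OF C, of "x + w" y] by (simp add: add.commute)
    ultimately show "C (x, y) = h x + h y - h (x + y)"
      by (simp add: eq_diff_eq)
  qed
qed

section \<open>Extension to the whole space by doubling\<close>

theorem borel_abelian_cocycle_cobound:
  fixes C :: "'a::euclidean_space \<times> 'a \<Rightarrow> 'g::{ab_group_add, countable}"
  assumes C: "abelian_cocycle C" and b: "borel_map C"
  obtains h where "borel_map h" "C = cobound h"
proof -
  obtain r h where r: "r > 0" and hb: "borel_map h"
    and h: "\<And>x y. norm x < r \<Longrightarrow> norm y < r \<Longrightarrow> norm (x + y) < r \<Longrightarrow> C (x, y) = h x + h y - h (x + y)"
    using abelian_cocycle_local_cobound[OF C b] by blast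
  let ?d = "\<lambda>x::'a. x /\<^sub>R 2"
  \<comment> \<open>The recursion is forced by \<open>C (a, a) = h a + h a - h (2 a)\<close>.\<close>
  define H where "H = rec_nat h (\<lambda>_ k x. k (?d x) + k (?d x) - C (?d x, ?d x))"
  have H0: "H 0 = h" and HS: "H (Suc j) x = H j (?d x) + H j (?d x) - C (?d x, ?d x)" for j x
    by (simp_all add: H_def)
  have half: "?d x + ?d x = x" for x by (simp flip: scaleR_add_left)
  have Hb: "borel_map (H j)" for j
  proof (induction j)
    case (Suc j)
    have "continuous_on UNIV ?d" "continuous_on UNIV (\<lambda>x. (?d x, ?d x))"
      by (intro continuous_intros)+
    then have "borel_map (\<lambda>x. H j (?d x))" "borel_map (\<lambda>x. C (?d x, ?d x))"
      using Suc b borel_map_compose_continuous by blast+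
    then have "borel_map (\<lambda>x. H j (?d x) + H j (?d x) + - C (?d x, ?d x))"
      by (intro borel_map_add borel_map_uminus)
    then show ?case by (simp add: HS[abs_def])
  qed (simp add: H0 hb)
  have Hc: "C (x, y) = H j x + H j y - H j (x + y)"
    if "norm x < 2^j * r" "norm y < 2^j * r" "norm (x + y) < 2^j * r" for j x y
    using that
  proof (induction j arbitrary: x y)
    case (Suc j)
    have dd: "?d (x + y) = ?d x + ?d y" by (simp add: scaleR_add_right)
    \<comment> \<open>Halving maps the ball of radius \<open>2^Suc j * r\<close> into the one where
      the induction hypothesis holds.\<close>
    have "norm (?d z) < 2^j * r" if "norm z < 2^Suc j * r" for z
      using that by simp
    then have IH: "C (?d x, ?d y) = H j (?d x) + H j (?d y) - H j (?d x + ?d y)"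
      using Suc.prems by (intro Suc.IH) (simp_all only: dd[symmetric])
    \<comment> \<open>The doubling identity expresses C(x,y) through C(x/2,y/2), known by induction,
      and diagonal terms, which are exactly the corrections in \<open>H (Suc j)\<close>.\<close>
    have "C (x, y) + C (?d x, ?d x) + C (?d y, ?d y)
      = C (?d x, ?d y) + C (?d x, ?d y) + C (?d x + ?d y, ?d x + ?d y)"
      using abelian_cocycle_double[OF C, of "?d x" "?d y"] by (simp only: half)
    then have "C (x, y) = C (?d x, ?d y) + C (?d x, ?d y) + C (?d x + ?d y, ?d x + ?d y)
      - C (?d x, ?d x) - C (?d y, ?d y)" by (simp add: algebra_simps)
    then show ?case unfolding HS dd IH by (simp add: algebra_simps)
  qed (simp add: H0 h)
  \<comment> \<open>Where \<open>H j\<close> already solves the equation, its instance at (x/2,x/2)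
    is the recursion itself, so the next stage changes nothing.\<close>
  have Hstep: "H (Suc j) x = H j x" if "norm x < 2^j * r" for j x
  proof -
    have "norm (?d x) \<le> norm x" by simp
    then have "norm (?d x) < 2^j * r" using that by (rule le_less_trans)
    then have "C (?d x, ?d x) = H j (?d x) + H j (?d x) - H j x"
      using Hc[of "?d x" j "?d x"] that by (simp only: half)
    then show ?thesis by (simp add: HS)
  qed
  have Hext: "H (j + k) x = H j x" if "norm x < 2^j * r" for j k x
  proof (induction k)
    case (Suc k)
    have "2^j * r \<le> 2^(j + k) * r" using r by (intro mult_right_mono power_increasing) auto
    then show ?case using Suc Hstep[of x "j + k"] that by simp
  qed simp
  have ex: "\<exists>j. a < 2^j * r" for a
    using real_arch_pow[of 2 "a / r"] r by (auto simp: pos_divide_less_eq)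
  define N where "N x = (LEAST j. norm x < 2^j * r)" for x :: 'a
  have N: "norm x < 2^(N x) * r" for x unfolding N_def using ex by (rule LeastI_ex)
  define k where "k x = H (N x) x" for x
  \<comment> \<open>Although \<open>k\<close> selects the least admissible stage pointwise, it
    agrees with \<open>H j\<close> on the entire \<open>j\<close>-th ball.\<close>
  have kH: "k x = H j x" if "norm x < 2^j * r" for x j
  proof -
    have "N x \<le> j" unfolding N_def using that by (rule Least_le)
    then show ?thesis using Hext[OF N, of x "j - N x"] by (simp add: k_def)
  qed
  show thesis
  proof
    show "borel_map k"
      unfolding borel_map_def
    \<comment> \<open>Countably many balls cover the space, and on each of them \<open>k\<close>
      coincides with a Borel map.\<close>
    proof (rule measurable_piecewise_restrict2[where A = "\<lambda>j. ball 0 (2^j * r)"])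
      show "space borel = (\<Union>j. ball (0::'a) (2^j * r))" using ex by auto
      show "\<exists>h\<in>borel \<rightarrow>\<^sub>M count_space UNIV. \<forall>x\<in>ball 0 (2^j * r). k x = h x" for j
        using Hb[of j] kH[of _ j] unfolding borel_map_def by (intro bexI[of _ "H j"]) auto
    qed auto
    show "C = cobound k"
    proof (rule ext, clarify)
      fix x y :: 'a
      \<comment> \<open>Bounding the sum of the norms places x, y and x+y in a single ball.\<close>
      obtain j where j: "norm x + norm y < 2^j * r"
        using ex by blast
      have lt: "norm x < 2^j * r" "norm y < 2^j * r" "norm (x + y) < 2^j * r"
        using j norm_triangle_ineq[of x y] norm_ge_zero[of x] norm_ge_zero[of y] by linarith+
      show "C (x, y) = cobound k (x, y)"
        using Hc[OF lt] kH lt by (simp add: cobound_def)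
    qed
  qed
qed

section \<open>Vanishing of the cohomology group\<close>

theorem theorem3p21:
  shows "trivial_group (H2_Bor :: ((real^2) \<times> (real^2) \<Rightarrow> 'g::{ab_group_add, countable}) set monoid)
    \<and> (\<forall>C :: (real^2) \<times> (real^2) \<Rightarrow> 'g. abelian_cocycle C \<and> borel_map C \<longrightarrow>
         (\<exists>h :: real^2 \<Rightarrow> 'g. borel_map h \<and> (\<forall>x y. C (x, y) = h x + h y - h (x + y))))"
proof
  let ?Z = "Z2_Bor :: ((real^2) \<times> (real^2) \<Rightarrow> 'g) monoid"
  let ?B = "{C :: (real^2) \<times> (real^2) \<Rightarrow> 'g. borel_coboundary C}"
  interpret Z: comm_group ?Z by (rule comm_group_Z2_Bor)
  have norm: "?B \<lhd> ?Z"
    by (rule Z.subgroup_imp_normal[OF subgroup_borel_coboundary])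
  have "carrier ?Z \<subseteq> ?B"
    by (auto simp: Z2_Bor_def borel_coboundary_def elim: borel_abelian_cocycle_cobound)
  \<comment> \<open>Every cocycle lies in the subgroup being divided out, so there is only one
    coset.\<close>
  then have "?B #>\<^bsub>?Z\<^esub> C = ?B" if "C \<in> carrier ?Z" for C
    using that by (intro Z.coset_join2[OF _ subgroup_borel_coboundary]) auto
  then have "carrier (?Z Mod ?B) \<subseteq> {\<one>\<^bsub>?Z Mod ?B\<^esub>}"
    by (auto simp: carrier_FactGroup)
  then show "trivial_group (H2_Bor :: ((real^2) \<times> (real^2) \<Rightarrow> 'g) set monoid)"
    unfolding H2_Bor_def
    using group.trivial_group_subset[OF normal.factorgroup_is_group[OF norm]] by blast
  show "\<forall>C :: (real^2) \<times> (real^2) \<Rightarrow> 'g. abelian_cocycle C \<and> borel_map C \<longrightarrow>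
         (\<exists>h :: real^2 \<Rightarrow> 'g. borel_map h \<and> (\<forall>x y. C (x, y) = h x + h y - h (x + y)))"
  proof (intro allI impI, elim conjE)
    fix C :: "(real^2) \<times> (real^2) \<Rightarrow> 'g"
    assume "abelian_cocycle C" "borel_map C"
    then obtain h where "borel_map h" "C = cobound h" by (rule borel_abelian_cocycle_cobound)
    then show "\<exists>h. borel_map h \<and> (\<forall>x y. C (x, y) = h x + h y - h (x + y))"
      by (auto simp: cobound_def)
  qed
qed

end
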